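(* Suppose $\mu$ is an equicontractive, self-similar, regular measure on $\mathbb{R}$ of finite type with support $[0,1]$. Then $\overline{\dim}_\Phi\mu<\infty$ for every dimension function $\Phi$ for which there is a constant $c>0$ such that $\Phi(x)\ge c\,\frac{\log|\log x|}{|\log x|}$ for all $x\in(0,1)$. In particular, $\dim_{qA}\mu<\infty$ for such measures $\mu$.
   Context: Let $S_j(x)=r_{\min}x+d_j$, $j=0,\dots,m$ ($m\ge1$), be an equicontractive IFS of similarities of $\mathbb{R}$ with common contraction factor $0<r_{\min}<1$, and let $p_j>0$ with $\sum_{j=0}^m p_j=1$. The associated self-similar measure is the unique Borel probability measure $\mu$ with $\mu(E)=\sum_j p_j\,\mu(S_j^{-1}(E))$ for all Borel $E$; its support is the self-similar set, i.e. the unique non-empty compact $K$ with $K=\bigcup_j S_j(K)$. For a word $w=(j_1,\dots,j_n)$, $S_w=S_{j_1}\circ\cdots\circ S_{j_n}$. The IFS and $\mu$ are of finite type if there is a finite set $F\subseteq\mathbb{R}$ such that whenever $v,w$ are words on $\{0,\dots,m\}$ of the same length $n$ and $c=\mathrm{diam}\,K$, either $|S_v(0)-S_w(0)|>c\,r_{\min}^n$ or $r_{\min}^{-n}|S_v(0)-S_w(0)|\in F$. Such a measure is regular if the probabilities associated with the left-most and right-most contractions (the maps with smallest and largest $d_j$) are equal and are minimal among all the $p_j$. A dimension function is a map $\Phi:(0,1)\to[0,\infty)$ such that $x^{1+\Phi(x)}$ decreases to $0$ as $x$ decreases to $0$. $\overline{\dim}_\Phi\mu$ is the infimum of all $\alpha$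 for which there exist $C_1,C_2>0$ such that for all $0<r<R^{1+\Phi(R)}\le R\le C_1$ and all $x\in\mathrm{supp}\,\mu$, $\mu(B(x,R))/\mu(B(x,r))\le C_2(R/r)^\alpha$ (open balls). With $\Phi_\theta$ the constant function $1/\theta-1$, $\theta\in(0,1)$, $\dim_{qA}\mu=\lim_{\theta\to1}\overline{\dim}_{\Phi_\theta}\mu$. *)

theory Defs
  imports "HOL-Probability.Probability"
begin

subsection \<open>Equicontractive self-similar measures\<close>

definition sim :: "real \<Rightarrow> (nat \<Rightarrow> real) \<Rightarrow> nat \<Rightarrow> real \<Rightarrow> real" where
  "sim r d j x = r * x + d j"

definition equicontractive_ifs :: "real \<Rightarrow> nat \<Rightarrow> (nat \<Rightarrow> real) \<Rightarrow> (nat \<Rightarrow> real) \<Rightarrow> bool" where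
  "equicontractive_ifs r m d p \<longleftrightarrow>
     1 \<le> m \<and> 0 < r \<and> r < 1 \<and> (\<forall>j\<le>m. 0 < p j) \<and> (\<Sum>j\<le>m. p j) = 1"

text \<open>The measure is given by its characterising property, which determines it uniquely for an
  equicontractive IFS.\<close>

definition self_similar_measure ::
    "real \<Rightarrow> nat \<Rightarrow> (nat \<Rightarrow> real) \<Rightarrow> (nat \<Rightarrow> real) \<Rightarrow> real measure \<Rightarrow> bool" where
  "self_similar_measure r m d p \<mu> \<longleftrightarrow>
     prob_space \<mu> \<and> sets \<mu> = sets borel \<and>
     (\<forall>E\<in>sets borel. measure \<mu> E = (\<Sum>j\<le>m. p j * measure \<mu> (sim r d j -` E)))"

definition measure_support :: "'a::topological_space measure \<Rightarrow> 'a set" where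
  "measure_support \<mu> = {x. \<forall>U. open U \<longrightarrow> x \<in> U \<longrightarrow> 0 < emeasure \<mu> U}"

definition self_similar_set :: "real \<Rightarrow> nat \<Rightarrow> (nat \<Rightarrow> real) \<Rightarrow> real set" where
  "self_similar_set r m d = (THE K. K \<noteq> {} \<and> compact K \<and> K = (\<Union>j\<le>m. sim r d j ` K))"

definition word_map :: "real \<Rightarrow> (nat \<Rightarrow> real) \<Rightarrow> nat list \<Rightarrow> real \<Rightarrow> real" where
  "word_map r d w = foldr (\<circ>) (map (sim r d) w) id"

definition finite_type :: "real \<Rightarrow> nat \<Rightarrow> (nat \<Rightarrow> real) \<Rightarrow> bool" where
  "finite_type r m d \<longleftrightarrow>
     (\<exists>F. finite F \<and>
       (\<forall>n v w. v \<in> lists {..m} \<longrightarrow> w \<in> lists {..m} \<longrightarrow> length v = n \<longrightarrow> length w = n \<longrightarrow>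
          \<bar>word_map r d v 0 - word_map r d w 0\<bar> > diameter (self_similar_set r m d) * r ^ n \<or>
          \<bar>word_map r d v 0 - word_map r d w 0\<bar> / r ^ n \<in> F))"

text \<open>No ordering of the translations is assumed. The left-most and right-most maps are the ones
  attaining the smallest and the largest translation, and each must be attained by exactly one
  index, so that it has a well-defined probability; other translations may coincide.\<close>

definition regular_ifs :: "nat \<Rightarrow> (nat \<Rightarrow> real) \<Rightarrow> (nat \<Rightarrow> real) \<Rightarrow> bool" where
  "regular_ifs m d p \<longleftrightarrow>
     (\<exists>a\<le>m. \<exists>b\<le>m. (\<forall>j\<le>m. j \<noteq> a \<longrightarrow> d a < d j) \<and> (\<forall>j\<le>m. j \<noteq> b \<longrightarrow> d j < d b) \<and>
        p a = p b \<and> (\<forall>j\<le>m. p a \<le> p j))"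

subsection \<open>Upper \<open>\<Phi>\<close>-dimensions\<close>

text \<open>Only the values of \<open>\<Phi>\<close> on the open unit interval matter; ``decreases'' is read in the weak
  sense.\<close>

definition dimension_function :: "(real \<Rightarrow> real) \<Rightarrow> bool" where
  "dimension_function \<Phi> \<longleftrightarrow>
     (\<forall>x\<in>{0<..<1}. 0 \<le> \<Phi> x) \<and>
     mono_on {0<..<1} (\<lambda>x. x powr (1 + \<Phi> x)) \<and>
     ((\<lambda>x. x powr (1 + \<Phi> x)) \<longlongrightarrow> 0) (at_right 0)"

text \<open>The bound \<open>C1 < 1\<close> keeps \<open>R\<close> in the domain of \<open>\<Phi>\<close>. The infimum is taken in the extended
  reals, so it is \<open>\<infinity>\<close> when no exponent is admissible.\<close>

definition upper_Phi_dim :: "(real \<Rightarrow> real) \<Rightarrow> real measure \<Rightarrow> ereal" where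
  "upper_Phi_dim \<Phi> \<mu> = Inf (ereal ` {\<alpha>. \<exists>C1 C2. 0 < C1 \<and> C1 < 1 \<and> 0 < C2 \<and>
     (\<forall>r R. \<forall>x\<in>measure_support \<mu>.
        0 < r \<longrightarrow> r < R powr (1 + \<Phi> R) \<longrightarrow> R powr (1 + \<Phi> R) \<le> R \<longrightarrow> 0 < R \<longrightarrow> R \<le> C1 \<longrightarrow>
        measure \<mu> (ball x R) / measure \<mu> (ball x r) \<le> C2 * (R / r) powr \<alpha>)})"

definition quasi_Assouad_dim :: "real measure \<Rightarrow> ereal" where
  "quasi_Assouad_dim \<mu> = Lim (at_left 1) (\<lambda>\<theta>. upper_Phi_dim (\<lambda>_. 1 / \<theta> - 1) \<mu>)"

end

theory Submission
  imports Defs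
begin

text \<open>Write \<open>S\<^sub>w\<close> for the map of a word \<open>w\<close>, \<open>p\<^sub>w\<close> for the product of its probabilities, \<open>q\<close> for
  the common, minimal probability of the two extreme maps, and \<open>M\<^sub>n(x)\<close> for the total weight of
  the words \<open>w\<close> of length \<open>n\<close> whose interval \<open>S\<^sub>w[0,1]\<close> contains \<open>x\<close>.  Then \<open>M\<^sub>n(x)\<close> controls
  the measure of balls around \<open>x\<close> on both sides.

  From below: a word whose interval contains \<open>x\<close> extends by \<open>k\<close> letters to one whose interval
  still contains \<open>x\<close>, at the cost of a factor at least \<open>q\<^sup>k\<close>; so a ball of radius larger than
  \<open>r\<^sup>n\<^sup>+\<^sup>k\<close> has measure at least \<open>q\<^sup>k M\<^sub>n(x)\<close> (\<open>measure_ball_ge\<close>).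

  From above: a ball of radius \<open>R\<close> has at most the weight of the words whose interval meets it.
  Finite type separates the distinct left end points of level \<open>n\<close> by \<open>\<delta> r\<^sup>n\<close>.  If
  \<open>R \<le> \<delta> r\<^sup>n\<close>, the intervals that meet the ball but miss \<open>x\<close> on its left therefore all end at one
  point \<open>y\<close>.  Such a word is \<open>w = w\<^sub>0 j b \<dots> b\<close> with \<open>b\<close> the right-most map and \<open>j \<noteq> b\<close>, so \<open>y\<close> is not
  the right end point of \<open>S\<^sub>w\<^sub>0[0,1]\<close>; hence some word \<open>v = w\<^sub>0 u\<close> of the same length has \<open>y\<close> in
  its interval but not as the right end point, and by separation this interval contains \<open>x\<close>.
  Since \<open>q\<close> is minimal, replacing the tail \<open>b \<dots> b\<close> by \<open>u\<close> loses at most a factor \<open>q\<close> of weight, and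
  each \<open>v\<close> arises from at most \<open>n (m + 1)\<close> words \<open>w\<close>.  So the weight near \<open>x\<close> is at most
  \<open>(1 + 2 n (m + 1) / q) M\<^sub>n(x)\<close> (\<open>weight_ending_left\<close> and \<open>weight_near\<close>, the right-hand side
  being treated by reflection).

  Choosing \<open>n\<close> and \<open>k\<close> with \<open>r\<^sup>n\<close> comparable to \<open>R\<close> and \<open>r\<^sup>n\<^sup>+\<^sup>k\<close> comparable to \<open>\<rho>\<close> gives
  \<open>\<mu>(B(x,R)) / \<mu>(B(x,\<rho>)) \<le> A (1 + \<bar>ln R\<bar>) (R / \<rho>)\<^sup>s\<close> with \<open>s = ln q / ln r\<close>
  (\<open>ball_ratio_logarithmic\<close>): doubling up to a logarithm.  The lower bound on \<open>\<Phi>\<close> says precisely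
  that \<open>\<rho> < R\<^sup>1\<^sup>+\<^sup>\<Phi>\<^sup>(\<^sup>R\<^sup>)\<close> forces \<open>R / \<rho> \<ge> \<bar>ln R\<bar>\<^sup>c\<close>, so the logarithm is absorbed into the
  exponent \<open>s + 1 / c\<close>.  A positive constant \<open>\<Phi>\<close> satisfies the bound with \<open>c = 1\<close> at all small
  scales, whence every \<open>\<Phi>\<^sub>\<theta>\<close>-dimension is at most \<open>s + 1\<close>, and so is their limit.\<close>

section \<open>Words and their affine maps\<close>

definition words :: "nat \<Rightarrow> nat \<Rightarrow> nat list set" where
  "words m n = {w. set w \<subseteq> {..m} \<and> length w = n}"

definition weight :: "(nat \<Rightarrow> real) \<Rightarrow> nat list \<Rightarrow> real" where
  "weight p w = prod_list (map p w)"

lemma finite_words: "finite (words m n)"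
  unfolding words_def by (rule finite_lists_length_eq) simp

lemma words_Suc: "words m (Suc n) = (\<lambda>(j, w). j # w) ` ({..m} \<times> words m n)"
  by (auto simp: words_def length_Suc_conv image_iff)

lemma sum_words_Suc: "(\<Sum>w\<in>words m (Suc n). f w) = (\<Sum>j\<le>m. \<Sum>w\<in>words m n. f (j # w))"
proof -
  have "(\<Sum>w\<in>words m (Suc n). f w) = (\<Sum>(j, w)\<in>{..m} \<times> words m n. f (j # w))"
    unfolding words_Suc
    by (subst sum.reindex) (auto simp: inj_on_def case_prod_beta)
  then show ?thesis
    by (simp add: sum.cartesian_product)
qed

lemma words_append: "v \<in> words m n \<Longrightarrow> w \<in> words m k \<Longrightarrow> v @ w \<in> words m (n + k)"
  by (auto simp: words_def)

lemma weight_append: "weight p (v @ w) = weight p v * weight p w"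
  by (simp add: weight_def)

lemma weight_Cons: "weight p (j # w) = p j * weight p w"
  by (simp add: weight_def)

lemma weight_nonneg: "w \<in> words m n \<Longrightarrow> (\<And>j. j \<le> m \<Longrightarrow> 0 \<le> p j) \<Longrightarrow> 0 \<le> weight p w"
  unfolding words_def weight_def by (induction w arbitrary: n) auto

lemma weight_ge_power:
  "w \<in> words m n \<Longrightarrow> (\<And>j. j \<le> m \<Longrightarrow> q \<le> p j) \<Longrightarrow> 0 \<le> q \<Longrightarrow> q ^ n \<le> weight p w"
proof (induction w arbitrary: n)
  case Nil
  then show ?case by (simp add: words_def weight_def)
next
  case (Cons j w)
  then obtain k where "n = Suc k" "w \<in> words m k" "j \<le> m"
    by (auto simp: words_def)
  then show ?case
    using Cons order_trans[of 0 q "p j"] by (auto simp: weight_Cons intro!: mult_mono)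
qed

lemma word_map_Nil [simp]: "word_map r d [] x = x"
  by (simp add: word_map_def)

lemma word_map_Cons [simp]: "word_map r d (j # w) x = r * word_map r d w x + d j"
  by (simp add: word_map_def sim_def)

lemma word_map_append: "word_map r d (v @ w) x = word_map r d v (word_map r d w x)"
  by (induction v) auto

lemma word_map_affine: "word_map r d w x = r ^ length w * x + word_map r d w 0"
  by (induction w) (auto simp: algebra_simps)

lemma word_map_mono: "0 \<le> r \<Longrightarrow> x \<le> y \<Longrightarrow> word_map r d w x \<le> word_map r d w y"
  by (subst (1 2) word_map_affine) (simp add: mult_left_mono)

lemma word_map_strict_mono: "0 < r \<Longrightarrow> x < y \<Longrightarrow> word_map r d w x < word_map r d w y"
  by (subst (1 2) word_map_affine) simp

text \<open>Conjugation by \<open>x \<mapsto> 1 - x\<close> replaces \<open>d j\<close> by \<open>1 - r - d j\<close> and exchanges left and right.\<close>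

lemma word_map_mirror: "word_map r (\<lambda>j. 1 - r - d j) w (1 - x) = 1 - word_map r d w x"
  by (induction w) (simp_all add: right_diff_distrib del: diff_diff_eq)

section \<open>Systems that cover the unit interval\<close>

text \<open>The geometric content of having support \<open>[0,1]\<close>, separated from the measure so that it can be
  reflected.\<close>

locale covering_ifs =
  fixes r :: real and m :: nat and d :: "nat \<Rightarrow> real"
  assumes r_pos: "0 < r" and r_less_1: "r < 1"
    and d_nonneg: "j \<le> m \<Longrightarrow> 0 \<le> d j"
    and d_upper: "j \<le> m \<Longrightarrow> d j + r \<le> 1"
    and cover: "0 \<le> x \<Longrightarrow> x \<le> 1 \<Longrightarrow> \<exists>j\<le>m. d j \<le> x \<and> x \<le> d j + r"
begin

abbreviation "S \<equiv> word_map r d"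

lemma covering_ifs_mirror: "covering_ifs r m (\<lambda>j. 1 - r - d j)"
proof
  fix x :: real assume "0 \<le> x" "x \<le> 1"
  then obtain j where "j \<le> m" "d j \<le> 1 - x" "1 - x \<le> d j + r"
    using cover[of "1 - x"] by auto
  then show "\<exists>j\<le>m. 1 - r - d j \<le> x \<and> x \<le> 1 - r - d j + r"
    by (intro exI[of _ j]) auto
qed (use r_pos r_less_1 d_nonneg d_upper in \<open>auto simp: algebra_simps\<close>)

text \<open>The intervals of the system are closed, but a point \<open>y < 1\<close> cannot be only a right end point of
  them: a point between \<open>y\<close> and the next translation is covered as well, necessarily by an interval
  that begins at or before \<open>y\<close>.\<close>

lemma cover_right:
  assumes "0 \<le> y" "y < 1"
  shows "\<exists>j\<le>m. d j \<le> y \<and> y < d j + r"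
proof -
  \<comment> \<open>\<open>Min T\<close> is the first translation beyond \<open>y\<close>, cut off at \<open>1\<close> so that \<open>T\<close> is non-empty and the
    midpoint taken below stays within \<open>[0,1]\<close>.\<close>
  define T where "T = insert 1 (d ` {j. j \<le> m \<and> y < d j})"
  have T: "finite T" "T \<noteq> {}"
    by (auto simp: T_def)
  have t: "y < Min T" "Min T \<le> 1"
    using T assms by (auto simp: T_def)
  obtain j where j: "j \<le> m" "d j \<le> (y + Min T) / 2" "(y + Min T) / 2 \<le> d j + r"
    using cover[of "(y + Min T) / 2"] t assms by auto
  have "d j \<le> y"
  proof (rule ccontr)
    assume "\<not> d j \<le> y"
    then have "Min T \<le> d j"
      using T(1) j(1) by (intro Min_le) (auto simp: T_def)
    then show False using j(2) t(1) by simp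
  qed
  then show ?thesis using j t(1) by (intro exI[of _ j]) auto
qed

lemma word_cover_right:
  assumes "0 \<le> y" "y < 1"
  shows "\<exists>u\<in>words m n. S u 0 \<le> y \<and> y < S u 1"
  using assms
proof (induction n arbitrary: y)
  case 0
  then show ?case by (auto simp: words_def)
next
  case (Suc n)
  obtain j where j: "j \<le> m" "d j \<le> y" "y < d j + r"
    using cover_right Suc.prems by blast
  have "0 \<le> (y - d j) / r" "(y - d j) / r < 1"
    using j r_pos by (auto simp: field_simps)
  then obtain u where u: "u \<in> words m n" "S u 0 \<le> (y - d j) / r" "(y - d j) / r < S u 1"
    using Suc.IH by blast
  show ?case
    using u j r_pos by (intro bexI[of _ "j # u"]) (auto simp: words_def field_simps)
qed

lemma word_cover:
  assumes "0 \<le> y" "y \<le> 1"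
  shows "\<exists>u\<in>words m n. S u 0 \<le> y \<and> y \<le> S u 1"
  using assms
proof (induction n arbitrary: y)
  case 0
  then show ?case by (auto simp: words_def)
next
  case (Suc n)
  obtain j where j: "j \<le> m" "d j \<le> y" "y \<le> d j + r"
    using cover Suc.prems by blast
  have "0 \<le> (y - d j) / r" "(y - d j) / r \<le> 1"
    using j r_pos by (auto simp: field_simps)
  then obtain u where u: "u \<in> words m n" "S u 0 \<le> (y - d j) / r" "(y - d j) / r \<le> S u 1"
    using Suc.IH by blast
  show ?case
    using u j r_pos by (intro bexI[of _ "j # u"]) (auto simp: words_def field_simps)
qed

lemma word_map_unit_interval:
  assumes "w \<in> words m n" "0 \<le> x" "x \<le> 1"
  shows "0 \<le> S w x \<and> S w x \<le> 1"
  using assms(1)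
proof (induction w arbitrary: n)
  case Nil
  then show ?case using assms by simp
next
  case (Cons j w)
  then have j: "j \<le> m" and "0 \<le> S w x" "S w x \<le> 1"
    by (auto simp: words_def)
  then have "0 \<le> r * S w x" "r * S w x \<le> r"
    using r_pos by (auto simp: mult_left_le)
  then show ?case
    using d_nonneg[OF j] d_upper[OF j] by simp
qed

lemma translation_max_eq:
  assumes "b \<le> m" "\<And>j. j \<le> m \<Longrightarrow> d j \<le> d b"
  shows "d b = 1 - r"
  using cover[of 1] assms d_upper by fastforce

text \<open>Two non-empty compact invariant sets coincide because the largest distance from a point of one
  to the other set is contracted by the factor \<open>r\<close>.  This gives finite type the explicit diameter
  \<open>1\<close>.\<close>

lemma self_similar_set_eq: "self_similar_set r m d = {0..1}"
  unfolding self_similar_set_def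
proof (rule the_equality)
  have "{0..1::real} = (\<Union>j\<le>m. sim r d j ` {0..1})"
  proof (intro equalityI subsetI)
    fix x :: real assume "x \<in> {0..1}"
    then obtain j where j: "j \<le> m" "d j \<le> x" "x \<le> d j + r"
      using cover by auto
    then have "x = sim r d j ((x - d j) / r)" "(x - d j) / r \<in> {0..1}"
      using r_pos by (auto simp: sim_def field_simps)
    then show "x \<in> (\<Union>j\<le>m. sim r d j ` {0..1})"
      using j(1) by blast
  next
    fix x assume "x \<in> (\<Union>j\<le>m. sim r d j ` {0..1})"
    then obtain j y where jy: "j \<le> m" "0 \<le> y" "y \<le> 1" "x = r * y + d j"
      by (auto simp: sim_def)
    then have "0 \<le> r * y" "r * y \<le> r"
      using r_pos by (auto simp: mult_left_le)
    then show "x \<in> {0..1}"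
      using jy d_nonneg[of j] d_upper[of j] by auto
  qed
  then show unit: "{0..1::real} \<noteq> {} \<and> compact {0..1::real} \<and> {0..1} = (\<Union>j\<le>m. sim r d j ` {0..1})"
    by simp
  fix K assume K: "K \<noteq> {} \<and> compact K \<and> K = (\<Union>j\<le>m. sim r d j ` K)"
  have sub: "K \<subseteq> L"
    if K: "K \<noteq> {}" "compact K" "K = (\<Union>j\<le>m. sim r d j ` K)"
      and L: "L \<noteq> {}" "compact L" "L = (\<Union>j\<le>m. sim r d j ` L)" for K L
  proof -
    have "continuous_on K (\<lambda>y. infdist y L)"
      by (intro continuous_intros)
    then obtain x where x: "x \<in> K" "\<And>y. y \<in> K \<Longrightarrow> infdist y L \<le> infdist x L"
      using continuous_attains_sup[OF K(2,1)] by blast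
    obtain j y where jy: "j \<le> m" "y \<in> K" "x = sim r d j y"
      using x(1) K(3) by blast
    obtain z where z: "z \<in> L" "infdist y L = dist y z"
      using infdist_attains_inf[OF compact_imp_closed[OF L(2)] L(1)] by metis
    have "sim r d j z \<in> L"
      using L(3) jy(1) z(1) by blast
    then have "infdist x L \<le> dist x (sim r d j z)"
      by (rule infdist_le)
    also have "\<dots> = r * infdist y L"
      using r_pos jy(3) z(2)
      by (simp add: sim_def dist_real_def abs_mult flip: right_diff_distrib)
    also have "\<dots> \<le> r * infdist x L"
      using x(2)[OF jy(2)] r_pos by simp
    finally have "(1 - r) * infdist x L \<le> 0"
      by (simp add: algebra_simps)
    then have "infdist x L \<le> 0"
      using r_less_1 by (simp add: mult_le_0_iff)
    show "K \<subseteq> L"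
    proof
      fix t assume "t \<in> K"
      then have "infdist t L = 0"
        using x(2) \<open>infdist x L \<le> 0\<close> infdist_nonneg[of t L] by fastforce
      then show "t \<in> L"
        using in_closed_iff_infdist_zero[OF compact_imp_closed[OF L(2)] L(1)] by simp
    qed
  qed
  show "K = {0..1}"
    using sub[of K "{0..1}"] sub[of "{0..1}" K] K unit by auto
qed

text \<open>The distances between distinct points of level \<open>n\<close>, divided by \<open>r\<^sup>n\<close>, exceed \<open>1\<close> or are among
  finitely many positive numbers.\<close>

lemma separation_constant:
  assumes "finite_type r m d"
  obtains \<delta> where "0 < \<delta>" "\<delta> \<le> 1"
    "\<And>n v w. v \<in> words m n \<Longrightarrow> w \<in> words m n \<Longrightarrow> S v 0 < S w 0 \<Longrightarrow> S v 0 + \<delta> * r ^ n \<le> S w 0"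
proof -
  obtain F where F: "finite F" and ft:
    "\<And>n v w. v \<in> lists {..m} \<Longrightarrow> w \<in> lists {..m} \<Longrightarrow> length v = n \<Longrightarrow> length w = n \<Longrightarrow>
       \<bar>S v 0 - S w 0\<bar> > r ^ n \<or> \<bar>S v 0 - S w 0\<bar> / r ^ n \<in> F"
    using assms unfolding finite_type_def self_similar_set_eq by auto
  define T where "T = insert 1 {t \<in> F. 0 < t}"
  have T: "finite T" "T \<noteq> {}"
    using F by (auto simp: T_def)
  show ?thesis
  proof (rule that)
    show "0 < Min T" "Min T \<le> 1"
      using T by (auto simp: T_def)
    fix n v w
    assume vw: "v \<in> words m n" "w \<in> words m n" and less: "S v 0 < S w 0"
    have rn: "0 < r ^ n" using r_pos by simp
    have "S w 0 - S v 0 > r ^ n \<or> (S w 0 - S v 0) / r ^ n \<in> F"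
      using ft[of v w n] vw less by (auto simp: words_def in_lists_conv_set)
    then have "Min T * r ^ n \<le> S w 0 - S v 0"
    proof
      assume "S w 0 - S v 0 > r ^ n"
      moreover have "Min T * r ^ n \<le> 1 * r ^ n"
        using \<open>Min T \<le> 1\<close> rn by (intro mult_right_mono) auto
      ultimately show ?thesis by simp
    next
      assume "(S w 0 - S v 0) / r ^ n \<in> F"
      then have "Min T \<le> (S w 0 - S v 0) / r ^ n"
        using T less rn by (intro Min_le) (auto simp: T_def)
      then show ?thesis
        using rn by (simp add: field_simps)
    qed
    then show "S v 0 + Min T * r ^ n \<le> S w 0" by simp
  qed
qed

definition coverers :: "nat \<Rightarrow> real \<Rightarrow> nat list set" where
  "coverers n x = {w \<in> words m n. S w 0 \<le> x \<and> x \<le> S w 1}"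

lemma finite_coverers: "finite (coverers n x)"
  unfolding coverers_def using finite_words by simp

text \<open>The only place where the extreme probability must be minimal.  A word \<open>w\<close> whose interval ends
  just before \<open>x\<close> is sent to a word \<open>v\<close> whose interval contains \<open>x\<close>: keep the part \<open>w\<^sub>0\<close> before the
  last letter \<open>j \<noteq> b\<close>, and replace \<open>j b \<dots> b\<close> by the address \<open>u\<close>, of equal length, of an interval
  which contains the point \<open>S\<^sub>j(1)\<close> and continues to its right.  Then \<open>p\<^sub>v \<ge> q p\<^sub>w\<close>.  The word \<open>w\<close> is
  recovered from \<open>v\<close>, \<open>j\<close> and the number of final letters \<open>b\<close>, which bounds the multiplicity by
  \<open>n (m + 1)\<close>.\<close>

lemma weight_ending_left:
  assumes p: "\<And>j. j \<le> m \<Longrightarrow> q \<le> p j" "\<And>j. j \<le> m \<Longrightarrow> p j \<le> 1" "0 < q"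
    and b: "b \<le> m" "\<And>j. j \<le> m \<Longrightarrow> j \<noteq> b \<Longrightarrow> d j < d b" "p b = q"
    and x: "x \<le> 1"
    and sep: "\<And>v w. v \<in> words m n \<Longrightarrow> w \<in> words m n \<Longrightarrow> S v 0 < S w 0 \<Longrightarrow>
                S v 0 + \<delta> * r ^ n \<le> S w 0"
  shows "(\<Sum>w | w \<in> words m n \<and> x - \<delta> * r ^ n < S w 1 \<and> S w 1 < x. weight p w)
           \<le> real n * (real m + 1) / q * (\<Sum>w\<in>coverers n x. weight p w)"
    (is "sum _ ?A \<le> _")
proof -
  have p0: "0 \<le> p j" if "j \<le> m" for j
    using p that by fastforce
  have db: "d b = 1 - r"
    using b by (intro translation_max_eq) (auto simp: less_imp_le, metis less_imp_le order_refl)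
  define T where "T = {..<n} \<times> {..m} \<times> coverers n x"
  \<comment> \<open>\<open>g\<close> recovers \<open>w\<close> from its image \<open>v\<close>, the letter \<open>j\<close> and the length \<open>k\<close> of the final block.\<close>
  define g where "g = (\<lambda>(k, j, v). take (n - Suc k) v @ j # replicate k b)"
  have "sum (weight p) ?A \<le> (\<Sum>(k, j, v)\<in>T. weight p v / q)"
  proof (rule sum_le_included[where i = g])
    show "finite ?A" using finite_words by simp
    show "finite T" by (simp add: T_def finite_coverers)
    show "\<forall>y\<in>T. 0 \<le> (case y of (k, j, v) \<Rightarrow> weight p v / q)"
      using p0 p(3) by (auto simp: T_def coverers_def intro!: divide_nonneg_pos weight_nonneg)
    show "\<forall>w\<in>?A. \<exists>y\<in>T. g y = w \<and> weight p w \<le> (case y of (k, j, v) \<Rightarrow> weight p v / q)"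
    proof
      fix w assume "w \<in> ?A"
      then have w: "w \<in> words m n" "x - \<delta> * r ^ n < S w 1" "S w 1 < x" by auto
      have rep: "S (replicate k b) 1 = 1" for k
        by (induction k) (auto simp: db)
      have "\<exists>j\<in>set w. j \<noteq> b"
      proof (rule ccontr)
        assume "\<not> ?thesis"
        then have "w = replicate (length w) b"
          by (metis replicate_length_same)
        then show False using rep w(3) x by (metis not_less)
      qed
      then obtain w0 j zs where dec: "w = w0 @ j # zs" "j \<noteq> b" "\<forall>z\<in>set zs. \<not> z \<noteq> b"
        using split_list_last_prop[of w "\<lambda>j. j \<noteq> b"] by auto
      define k where "k = length zs"
      have zs: "zs = replicate k b"
        using dec(3) unfolding k_def by (metis replicate_length_same)
      have len: "n = length w0 + Suc k" and j: "j \<le> m" and w0: "w0 \<in> words m (length w0)"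
        using w(1) dec(1) by (auto simp: words_def k_def)
      have "S w 1 = S w0 (r + d j)"
        by (simp add: dec(1) zs word_map_append rep)
      have "0 \<le> r + d j" "r + d j < 1"
        using b(2)[OF j dec(2)] db d_nonneg[OF j] r_pos by auto
      then obtain u where u: "u \<in> words m (Suc k)" "S u 0 \<le> r + d j" "r + d j < S u 1"
        using word_cover_right by blast
      define v where "v = w0 @ u"
      have v: "v \<in> words m n"
        using words_append[OF w0 u(1)] len by (simp add: v_def)
      have v0: "S v 0 \<le> S w 1" and v1: "S w 1 < S v 1"
        unfolding \<open>S w 1 = _\<close> v_def word_map_append
        using u r_pos by (auto intro: word_map_mono word_map_strict_mono)
      have lens: "length v = n" "length w = n"
        using v w(1) by (auto simp: words_def)
      \<comment> \<open>Intervals of one level have equal length, so right end points are separated like left ones.\<close>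
      have "S w 0 + \<delta> * r ^ n \<le> S v 0"
        using v1 lens word_map_affine[of r d w 1] word_map_affine[of r d v 1]
        by (intro sep w v) simp
      then have "S w 1 + \<delta> * r ^ n \<le> S v 1"
        using lens word_map_affine[of r d w 1] word_map_affine[of r d v 1] by simp
      then have vc: "v \<in> coverers n x"
        using v v0 w by (auto simp: coverers_def)
      have "weight p w = weight p w0 * (p j * q ^ k)"
        by (simp add: dec(1) zs weight_append weight_Cons)
           (simp add: weight_def b(3) prod_list_replicate)
      also have "\<dots> \<le> weight p w0 * (1 * q ^ k)"
        using p(2)[OF j] p(3) weight_nonneg[OF w0] p0
        by (intro mult_left_mono mult_right_mono) auto
      also have "\<dots> = weight p w0 * q ^ Suc k / q"
        using p(3) by simp
      also have "\<dots> \<le> weight p w0 * weight p u / q"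
        using p weight_nonneg[OF w0] p0 weight_ge_power[OF u(1), of q p]
        by (intro divide_right_mono mult_left_mono) auto
      finally have "weight p w \<le> weight p v / q"
        by (simp add: v_def weight_append)
      moreover have "g (k, j, v) = w"
        using len by (simp add: g_def v_def dec(1) zs)
      moreover have "(k, j, v) \<in> T"
        using len j vc by (simp add: T_def)
      ultimately show "\<exists>y\<in>T. g y = w \<and> weight p w \<le> (case y of (k, j, v) \<Rightarrow> weight p v / q)"
        by (intro bexI[of _ "(k, j, v)"]) auto
    qed
  qed
  also have "\<dots> = real n * (real m + 1) / q * (\<Sum>w\<in>coverers n x. weight p w)"
    unfolding T_def
    by (simp add: sum.cartesian_product[symmetric] sum_divide_distrib[symmetric] field_simps)
  finally show ?thesis .
qed

lemma coverers_mirror: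
  "covering_ifs.coverers r m (\<lambda>j. 1 - r - d j) n (1 - x) = coverers n x"
  using word_map_mirror[of r d _ 0] word_map_mirror[of r d _ 1]
  unfolding coverers_def covering_ifs.coverers_def[OF covering_ifs_mirror]
  by auto

text \<open>A word whose interval meets the ball contains \<open>x\<close>, or ends to the left of \<open>x\<close>, or begins to its
  right; the last case is the second one for the reflected system, in which the left-most map has
  become the right-most.\<close>

lemma weight_near:
  assumes p: "\<And>j. j \<le> m \<Longrightarrow> q \<le> p j" "\<And>j. j \<le> m \<Longrightarrow> p j \<le> 1" "0 < q"
    and a: "a \<le> m" "\<And>j. j \<le> m \<Longrightarrow> j \<noteq> a \<Longrightarrow> d a < d j" "p a = q"
    and b: "b \<le> m" "\<And>j. j \<le> m \<Longrightarrow> j \<noteq> b \<Longrightarrow> d j < d b" "p b = q"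
    and x: "0 \<le> x" "x \<le> 1"
    and sep: "\<And>v w. v \<in> words m n \<Longrightarrow> w \<in> words m n \<Longrightarrow> S v 0 < S w 0 \<Longrightarrow>
                S v 0 + \<delta> * r ^ n \<le> S w 0"
    and R: "R \<le> \<delta> * r ^ n"
  shows "(\<Sum>w | w \<in> words m n \<and> S w 0 < x + R \<and> x - R < S w 1. weight p w)
           \<le> (1 + 2 * (real n * (real m + 1) / q)) * (\<Sum>w\<in>coverers n x. weight p w)"
    (is "sum _ ?N \<le> _")
proof -
  define A where "A = {w \<in> words m n. x - \<delta> * r ^ n < S w 1 \<and> S w 1 < x}"
  define B where "B = {w \<in> words m n. x < S w 0 \<and> S w 0 < x + \<delta> * r ^ n}"
  define c where "c = real n * (real m + 1) / q"
  define M where "M = (\<Sum>w\<in>coverers n x. weight p w)"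
  let ?d = "\<lambda>j. 1 - r - d j"
  interpret mirror: covering_ifs r m ?d
    by (rule covering_ifs_mirror)
  have w0: "0 \<le> weight p w" if "w \<in> words m n" for w
    using that p by (intro weight_nonneg) (auto intro: order_trans[of 0 q])
  have mirror_ends: "word_map r ?d w 1 = 1 - S w 0" "word_map r ?d w 0 = 1 - S w 1" for w
    using word_map_mirror[of r d w 0] word_map_mirror[of r d w 1] by auto
  have left: "sum (weight p) A \<le> c * M"
    unfolding A_def c_def M_def using p b x sep
    by (intro weight_ending_left[where b = b and q = q]) auto
  have "(\<Sum>w | w \<in> words m n \<and> 1 - x - \<delta> * r ^ n < word_map r ?d w 1 \<and>
            word_map r ?d w 1 < 1 - x. weight p w)
      \<le> real n * (real m + 1) / q * (\<Sum>w\<in>mirror.coverers n (1 - x). weight p w)"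
  proof (rule mirror.weight_ending_left
      [where p = p and q = q and b = a and x = "1 - x" and \<delta> = \<delta> and n = n])
    fix v w
    assume vw: "v \<in> words m n" "w \<in> words m n" "word_map r ?d v 0 < word_map r ?d w 0"
    have "length v = n" "length w = n"
      using vw by (auto simp: words_def)
    then show "word_map r ?d v 0 + \<delta> * r ^ n \<le> word_map r ?d w 0"
      using sep[OF vw(2,1)] vw(3) word_map_affine[of r d v 1] word_map_affine[of r d w 1]
      by (simp add: mirror_ends)
  next
    fix j assume "j \<le> m" "j \<noteq> a"
    then show "1 - r - d j < 1 - r - d a"
      using a(2) by simp
  qed (use p a x in \<open>simp_all\<close>)
  then have "(\<Sum>w | w \<in> words m n \<and> 1 - x - \<delta> * r ^ n < 1 - S w 0 \<and> 1 - S w 0 < 1 - x. weight p w)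
      \<le> c * M"
    unfolding coverers_mirror mirror_ends c_def M_def .
  also have "{w. w \<in> words m n \<and> 1 - x - \<delta> * r ^ n < 1 - S w 0 \<and> 1 - S w 0 < 1 - x} = B"
    unfolding B_def by (rule Collect_cong) linarith
  finally have right: "sum (weight p) B \<le> c * M" .
  have union: "sum (weight p) (X \<union> Y) \<le> sum (weight p) X + sum (weight p) Y"
    if "X \<subseteq> words m n" "Y \<subseteq> words m n" for X Y
  proof -
    have "finite X" "finite Y"
      using that finite_words finite_subset by blast+
    moreover have "0 \<le> sum (weight p) (X \<inter> Y)"
      using that by (intro sum_nonneg w0) blast
    ultimately show ?thesis
      by (simp add: sum_Un)
  qed
  have sub: "A \<subseteq> words m n" "B \<subseteq> words m n" "coverers n x \<subseteq> words m n"
    by (auto simp: A_def B_def coverers_def)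
  have "?N \<subseteq> A \<union> (B \<union> coverers n x)"
  proof
    fix w assume "w \<in> ?N"
    then have "w \<in> words m n" "S w 0 < x + \<delta> * r ^ n" "x - \<delta> * r ^ n < S w 1"
      using R by auto
    then show "w \<in> A \<union> (B \<union> coverers n x)"
      by (cases "S w 1 < x"; cases "x < S w 0") (auto simp: A_def B_def coverers_def)
  qed
  then have "sum (weight p) ?N \<le> sum (weight p) (A \<union> (B \<union> coverers n x))"
    using sub by (intro sum_mono2 finite_subset[OF _ finite_words[of m n]] w0) blast+
  also have "\<dots> \<le> sum (weight p) A + (sum (weight p) B + sum (weight p) (coverers n x))"
    using union[of A "B \<union> coverers n x"] union[of B "coverers n x"] sub by auto
  also have "\<dots> \<le> c * M + (c * M + M)"
    using left right by (simp add: M_def)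
  also have "\<dots> = (1 + 2 * c) * M"
    by (simp add: algebra_simps)
  finally show ?thesis
    by (simp add: c_def M_def)
qed

end

section \<open>Balls and words\<close>

text \<open>In a second countable space, countably many null open sets cover the complement of the
  support.\<close>

lemma measure_disjoint_support:
  fixes \<mu> :: "'a::second_countable_topology measure"
  assumes sets: "sets \<mu> = sets borel" and E: "E \<inter> measure_support \<mu> = {}"
  shows "measure \<mu> E = 0"
proof -
  define \<F> where "\<F> = {U. open U \<and> emeasure \<mu> U = 0}"
  obtain \<G> where \<G>: "\<G> \<subseteq> \<F>" "countable \<G>" "\<Union>\<G> = \<Union>\<F>"
    by (rule Lindelof[of \<F>]) (auto simp: \<F>_def)
  have "(\<Union>U\<in>\<G>. U) \<in> null_sets \<mu>"
    using \<G> sets by (intro null_sets_UN' ) (auto simp: \<F>_def null_sets_def)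
  moreover have "E \<subseteq> \<Union>\<G>"
  proof
    fix x assume "x \<in> E"
    then have "x \<notin> measure_support \<mu>" using E by blast
    then obtain U where "open U" "x \<in> U" "emeasure \<mu> U = 0"
      unfolding measure_support_def by (auto simp: not_gr_zero)
    then show "x \<in> \<Union>\<G>"
      unfolding \<G>(3) \<F>_def by blast
  qed
  ultimately have "emeasure \<mu> E = 0"
    using null_sets_subset[of "\<Union>\<G>" \<mu> E] emeasure_notin_sets[of E \<mu>]
    by (cases "E \<in> sets \<mu>") (auto simp: null_sets_def)
  then show ?thesis
    by (simp add: measure_def)
qed

lemma continuous_on_word_map: "continuous_on UNIV (word_map r d w)"
  by (subst word_map_affine[abs_def]) (intro continuous_intros)

lemma vimage_word_map_borel:
  assumes "E \<in> sets borel"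
  shows "word_map r d w -` E \<in> sets borel"
  using measurable_sets_borel[OF borel_measurable_continuous_onI[OF continuous_on_word_map] assms]
  by simp

lemma measure_words_eq:
  assumes ss: "self_similar_measure r m d p \<mu>" and E: "E \<in> sets borel"
  shows "measure \<mu> E = (\<Sum>w\<in>words m n. weight p w * measure \<mu> (word_map r d w -` E))"
  using E
proof (induction n arbitrary: E)
  case 0
  have "words m 0 = {[]}" by (auto simp: words_def)
  moreover have "word_map r d [] -` E = E" by auto
  ultimately show ?case by (simp add: weight_def)
next
  case (Suc n)
  have sim: "sim r d j = word_map r d [j]" for j
    by (simp add: sim_def fun_eq_iff)
  have "measure \<mu> E = (\<Sum>j\<le>m. p j * measure \<mu> (sim r d j -` E))"
    using ss Suc.prems by (simp add: self_similar_measure_def)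
  also have "\<dots> = (\<Sum>j\<le>m. p j *
      (\<Sum>w\<in>words m n. weight p w * measure \<mu> (word_map r d w -` (sim r d j -` E))))"
    using Suc by (intro sum.cong refl arg_cong2[where f = "(*)"])
      (simp add: sim vimage_word_map_borel)
  also have "\<dots> = (\<Sum>j\<le>m. \<Sum>w\<in>words m n.
      weight p (j # w) * measure \<mu> (word_map r d (j # w) -` E))"
    by (intro sum.cong refl)
      (auto simp: sum_distrib_left weight_Cons sim_def vimage_def mult.assoc intro!: sum.cong)
  finally show ?case
    by (simp add: sum_words_Suc)
qed

text \<open>Each map sends the support into itself, since its preimage of a null open set is again null.  And
  the intervals cover \<open>[0,1]\<close>, since the preimages of the open complement of their union miss the
  support, so that this complement is null.\<close>

lemma covering_ifs_of_support:
  assumes ifs: "equicontractive_ifs r m d p"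
    and ss: "self_similar_measure r m d p \<mu>"
    and supp: "measure_support \<mu> = {0..1}"
  shows "covering_ifs r m d"
proof -
  interpret prob_space \<mu> using ss by (simp add: self_similar_measure_def)
  have sets: "sets \<mu> = sets borel"
    and eq: "\<And>E. E \<in> sets borel \<Longrightarrow>
      measure \<mu> E = (\<Sum>j\<le>m. p j * measure \<mu> (sim r d j -` E))"
    using ss by (auto simp: self_similar_measure_def)
  have r: "0 < r" "r < 1" and p: "\<And>j. j \<le> m \<Longrightarrow> 0 < p j"
    using ifs by (auto simp: equicontractive_ifs_def)
  have cont: "continuous_on UNIV (sim r d j)" for j
    unfolding sim_def by (intro continuous_intros)
  have open_supp: "0 < measure \<mu> U" if "open U" "x \<in> U" "0 \<le> x" "x \<le> 1" for U x
  proof -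
    have "0 < emeasure \<mu> U"
      using that supp unfolding measure_support_def by (auto simp: set_eq_iff)
    then show ?thesis
      by (simp add: emeasure_eq_measure)
  qed
  have inv: "0 \<le> sim r d j x \<and> sim r d j x \<le> 1" if j: "j \<le> m" and x: "0 \<le> x" "x \<le> 1" for j x
  proof (rule ccontr)
    assume out: "\<not> ?thesis"
    have "open (- {0..1::real})" by (simp add: open_Compl)
    then have U: "open (sim r d j -` (- {0..1}))"
      using cont by (rule open_vimage)
    have "measure \<mu> (- {0..1}) = 0"
      using sets supp by (intro measure_disjoint_support) auto
    then have "(\<Sum>j\<le>m. p j * measure \<mu> (sim r d j -` (- {0..1}))) = 0"
      by (subst eq[symmetric]) auto
    then have "p j * measure \<mu> (sim r d j -` (- {0..1})) = 0"
      using j p by (subst (asm) sum_nonneg_eq_0_iff) (auto simp: less_imp_le)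
    then have "measure \<mu> (sim r d j -` (- {0..1})) = 0"
      using p[OF j] by simp
    then show False
      using open_supp[OF U _ x] out by auto
  qed
  show ?thesis
  proof
    show "0 < r" "r < 1" by fact+
    fix j assume "j \<le> m"
    then show "0 \<le> d j" "d j + r \<le> 1"
      using inv[of j 0] inv[of j 1] by (auto simp: sim_def)
  next
    fix x :: real assume x: "0 \<le> x" "x \<le> 1"
    show "\<exists>j\<le>m. d j \<le> x \<and> x \<le> d j + r"
    proof (rule ccontr)
      assume no: "\<not> ?thesis"
      define U where "U = - (\<Union>j\<le>m. {d j..d j + r})"
      have "open U" unfolding U_def by (intro open_Compl closed_UN) auto
      have "measure \<mu> (sim r d j -` U) = 0" if "j \<le> m" for j
      proof (rule measure_disjoint_support[OF sets])
        have "sim r d j y \<notin> U" if "0 \<le> y" "y \<le> 1" for y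
          using that r \<open>j \<le> m\<close> by (auto simp: U_def sim_def mult_left_le intro!: bexI[of _ j])
        then show "sim r d j -` U \<inter> measure_support \<mu> = {}"
          by (auto simp: supp)
      qed
      then have "measure \<mu> U = 0"
        using \<open>open U\<close> by (subst eq) auto
      moreover have "x \<in> U" using no by (auto simp: U_def)
      ultimately show False
        using open_supp[OF \<open>open U\<close> _ x] by simp
    qed
  qed
qed

context covering_ifs
begin

lemma measure_ball_le:
  assumes ss: "self_similar_measure r m d p \<mu>" and supp: "measure_support \<mu> = {0..1}"
    and p: "\<And>j. j \<le> m \<Longrightarrow> 0 \<le> p j"
  shows "measure \<mu> (ball x R)
    \<le> (\<Sum>w | w \<in> words m n \<and> S w 0 < x + R \<and> x - R < S w 1. weight p w)"
    (is "_ \<le> sum _ ?N")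
proof -
  interpret prob_space \<mu> using ss by (simp add: self_similar_measure_def)
  have sets: "sets \<mu> = sets borel"
    using ss by (simp add: self_similar_measure_def)
  have zero: "measure \<mu> (S w -` ball x R) = 0" if "w \<notin> ?N" "w \<in> words m n" for w
  proof (rule measure_disjoint_support[OF sets])
    have "S w y \<notin> ball x R" if "0 \<le> y" "y \<le> 1" for y
      using word_map_mono[of r 0 y d w] word_map_mono[of r y 1 d w] that r_pos
        \<open>w \<notin> ?N\<close> \<open>w \<in> words m n\<close> by (auto simp: dist_real_def)
    then show "S w -` ball x R \<inter> measure_support \<mu> = {}"
      by (auto simp: supp)
  qed
  have "measure \<mu> (ball x R) = (\<Sum>w\<in>words m n. weight p w * measure \<mu> (S w -` ball x R))"
    by (rule measure_words_eq[OF ss]) simp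
  also have "\<dots> = (\<Sum>w\<in>?N. weight p w * measure \<mu> (S w -` ball x R))"
    using zero by (intro sum.mono_neutral_right finite_words) auto
  also have "\<dots> \<le> sum (weight p) ?N"
    using p by (intro sum_mono mult_left_le) (auto intro: weight_nonneg)
  finally show ?thesis .
qed

text \<open>Extending every word whose interval contains \<open>x\<close> to a shorter interval around \<open>x\<close> is injective,
  and all the extended words carry their full weight into the ball.\<close>

lemma measure_ball_ge:
  assumes ss: "self_similar_measure r m d p \<mu>" and supp: "measure_support \<mu> = {0..1}"
    and p: "\<And>j. j \<le> m \<Longrightarrow> q \<le> p j" "0 \<le> q"
    and \<rho>: "r ^ (n + k) < \<rho>"
  shows "q ^ k * (\<Sum>w\<in>coverers n x. weight p w) \<le> measure \<mu> (ball x \<rho>)"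
proof -
  interpret prob_space \<mu> using ss by (simp add: self_similar_measure_def)
  have sets: "sets \<mu> = sets borel"
    using ss by (simp add: self_similar_measure_def)
  have p0: "0 \<le> p j" if "j \<le> m" for j
    using p that by (auto intro: order_trans)
  have "\<exists>u\<in>words m k. S (w @ u) 0 \<le> x \<and> x \<le> S (w @ u) 1" if w: "w \<in> coverers n x" for w
  proof -
    have len: "length w = n" and w01: "S w 0 \<le> x" "x \<le> S w 1"
      using w by (auto simp: coverers_def words_def)
    define y where "y = (x - S w 0) / r ^ n"
    have y: "0 \<le> y" "y \<le> 1" and xy: "x = S w y"
      using w01 r_pos word_map_affine[of r d w 1] word_map_affine[of r d w y] len
      by (auto simp: y_def field_simps)
    obtain u where u: "u \<in> words m k" "S u 0 \<le> y" "y \<le> S u 1"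
      using word_cover[OF y] by blast
    then show ?thesis
      using r_pos by (intro bexI[of _ u]) (auto simp: word_map_append xy intro!: word_map_mono)
  qed
  then obtain u where u: "\<And>w. w \<in> coverers n x \<Longrightarrow> u w \<in> words m k"
    "\<And>w. w \<in> coverers n x \<Longrightarrow> S (w @ u w) 0 \<le> x \<and> x \<le> S (w @ u w) 1"
    by metis
  define h where "h w = w @ u w" for w
  have h: "h w \<in> words m (n + k)" if "w \<in> coverers n x" for w
    using that u(1) by (auto simp: h_def coverers_def intro!: words_append)
  have inj: "inj_on h (coverers n x)"
    by (rule inj_onI) (auto simp: h_def coverers_def words_def)
  have one: "measure \<mu> (S (h w) -` ball x \<rho>) = 1" if w: "w \<in> coverers n x" for w
  proof -
    have "S (h w) y \<in> ball x \<rho>" if y: "0 \<le> y" "y \<le> 1" for y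
    proof -
      have "S (h w) 1 - S (h w) 0 = r ^ (n + k)"
        using h[OF w] word_map_affine[of r d "h w" 1] by (auto simp: words_def)
      moreover have "S (h w) 0 \<le> S (h w) y" "S (h w) y \<le> S (h w) 1"
        using y r_pos by (auto intro!: word_map_mono)
      ultimately show ?thesis
        using u(2)[OF w] \<rho> by (auto simp: h_def dist_real_def)
    qed
    then have "measure \<mu> (- (S (h w) -` ball x \<rho>)) = 0"
      by (intro measure_disjoint_support[OF sets]) (auto simp: supp)
    moreover have "S (h w) -` ball x \<rho> \<in> sets \<mu>"
      unfolding sets by (rule vimage_word_map_borel) simp
    ultimately show ?thesis
      using prob_compl[of "S (h w) -` ball x \<rho>"] sets_eq_imp_space_eq[OF sets]
      by (simp add: Compl_eq_Diff_UNIV)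
  qed
  have "q ^ k * (\<Sum>w\<in>coverers n x. weight p w) = (\<Sum>w\<in>coverers n x. weight p w * q ^ k)"
    by (simp add: sum_distrib_left mult.commute)
  also have "\<dots> \<le> (\<Sum>w\<in>coverers n x. weight p (h w) * measure \<mu> (S (h w) -` ball x \<rho>))"
  proof (rule sum_mono)
    fix w assume w: "w \<in> coverers n x"
    have "weight p w * q ^ k \<le> weight p w * weight p (u w)"
      using w u(1)[OF w] p p0
      by (intro mult_left_mono weight_ge_power weight_nonneg[of _ m n]) (auto simp: coverers_def)
    then show "weight p w * q ^ k \<le> weight p (h w) * measure \<mu> (S (h w) -` ball x \<rho>)"
      using one[OF w] by (simp add: h_def weight_append)
  qed
  also have "\<dots> = (\<Sum>v\<in>h ` coverers n x. weight p v * measure \<mu> (S v -` ball x \<rho>))"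
    using inj by (simp add: sum.reindex)
  also have "\<dots> \<le> (\<Sum>v\<in>words m (n + k). weight p v * measure \<mu> (S v -` ball x \<rho>))"
    using h p0 by (intro sum_mono2 finite_words)
      (auto intro!: mult_nonneg_nonneg weight_nonneg[of _ m "n + k"])
  also have "\<dots> = measure \<mu> (ball x \<rho>)"
    by (rule measure_words_eq[OF ss, symmetric]) simp
  finally show ?thesis .
qed

end

text \<open>\<open>r\<^sup>n\<close> is comparable to \<open>R\<close> and \<open>r\<^sup>n\<^sup>+\<^sup>k\<close> to \<open>\<rho>\<close>, each within the side on which the two ball
  estimates apply.\<close>

lemma geometric_scales:
  fixes r \<delta> \<rho> R :: real
  assumes r: "0 < r" "r < 1" and \<delta>: "0 < \<delta>" "\<delta> \<le> 1" and R: "0 < \<rho>" "\<rho> < R" "R \<le> \<delta>"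
  obtains n k where "R \<le> \<delta> * r ^ n" "\<delta> * r ^ Suc n < R" "r ^ (n + k) < \<rho>" "r * \<rho> \<le> r ^ (n + k)"
proof -
  have least: "\<exists>n. t \<le> r ^ n \<and> r ^ Suc n < t" if t: "0 < t" "t \<le> 1" for t
  proof -
    obtain i where "r ^ i < t"
      using real_arch_pow_inv[OF t(1) r(2)] by blast
    then have "\<exists>n<i. (\<forall>j\<le>n. \<not> r ^ j < t) \<and> r ^ Suc n < t"
      using t by (intro ex_least_nat_less[of "\<lambda>i. r ^ i < t" i]) auto
    then show ?thesis by (meson not_less order_refl)
  qed
  obtain n where n: "R / \<delta> \<le> r ^ n" "r ^ Suc n < R / \<delta>"
    using least[of "R / \<delta>"] R \<delta> by auto
  obtain l where l: "\<rho> \<le> r ^ l" "r ^ Suc l < \<rho>"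
    using least[of \<rho>] R \<delta> by auto
  have "r ^ Suc l < r ^ n"
  proof -
    have "R \<le> R / \<delta>"
      using R \<delta> by (simp add: field_simps)
    then show ?thesis using l n R by linarith
  qed
  then have "n \<le> Suc l"
    using r by (auto simp del: power_Suc)
  show ?thesis
  proof (rule that[of n "Suc l - n"])
    show "R \<le> \<delta> * r ^ n" "\<delta> * r ^ Suc n < R"
      using n \<delta> by (auto simp: field_simps)
    show "r ^ (n + (Suc l - n)) < \<rho>" "r * \<rho> \<le> r ^ (n + (Suc l - n))"
      using l r \<open>n \<le> Suc l\<close> by auto
  qed
qed

text \<open>Doubling up to a logarithm: the number of levels \<open>n\<close> in \<open>weight_near\<close> is of order \<open>\<bar>ln R\<bar>\<close>, and
  the factor \<open>q\<^sup>-\<^sup>k\<close> from \<open>measure_ball_ge\<close> is the power \<open>s = ln q / ln r\<close> of \<open>r\<^sup>-\<^sup>k\<close>, which is of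
  order \<open>R / \<rho>\<close>.\<close>

lemma ball_ratio_logarithmic:
  assumes ifs: "equicontractive_ifs r m d p"
    and ss: "self_similar_measure r m d p \<mu>"
    and ft: "finite_type r m d"
    and reg: "regular_ifs m d p"
    and supp: "measure_support \<mu> = {0..1}"
  obtains \<delta> A s where "0 < \<delta>" "0 < A"
    "\<And>x R \<rho>. 0 \<le> x \<Longrightarrow> x \<le> 1 \<Longrightarrow> 0 < \<rho> \<Longrightarrow> \<rho> < R \<Longrightarrow> R \<le> \<delta> \<Longrightarrow>
       measure \<mu> (ball x R) \<le> A * (1 + \<bar>ln R\<bar>) * (R / \<rho>) powr s * measure \<mu> (ball x \<rho>)"
proof -
  interpret covering_ifs r m d
    by (rule covering_ifs_of_support[OF ifs ss supp])
  have p_pos: "\<And>j. j \<le> m \<Longrightarrow> 0 < p j" and p_sum: "(\<Sum>j\<le>m. p j) = 1"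
    using ifs by (auto simp: equicontractive_ifs_def)
  obtain a b where a: "a \<le> m" "\<And>j. j \<le> m \<Longrightarrow> j \<noteq> a \<Longrightarrow> d a < d j"
    and b: "b \<le> m" "\<And>j. j \<le> m \<Longrightarrow> j \<noteq> b \<Longrightarrow> d j < d b"
    and q: "p b = p a" "\<And>j. j \<le> m \<Longrightarrow> p a \<le> p j"
    using reg unfolding regular_ifs_def by metis
  define q where "q = p a"
  have q_pos: "0 < q" using p_pos a(1) by (simp add: q_def)
  have p_le_1: "p j \<le> 1" if "j \<le> m" for j
    using member_le_sum[of j "{..m}" p] that p_pos p_sum by (auto simp: less_imp_le)
  obtain \<delta> where \<delta>: "0 < \<delta>" "\<delta> \<le> 1" and sep:
    "\<And>n v w. v \<in> words m n \<Longrightarrow> w \<in> words m n \<Longrightarrow> S v 0 < S w 0 \<Longrightarrow> S v 0 + \<delta> * r ^ n \<le> S w 0"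
    using separation_constant[OF ft] by blast
  define L where "L = - ln r"
  have L: "0 < L" using r_pos r_less_1 by (simp add: L_def)
  \<comment> \<open>The exponent with \<open>q = r\<^sup>s\<close>, which turns \<open>q\<^sup>-\<^sup>k\<close> into a power of the scale ratio.\<close>
  define s where "s = - ln q / L"
  have s: "0 \<le> s"
    using L q_pos p_le_1[OF a(1)] unfolding s_def by (intro divide_nonneg_pos) (simp_all add: q_def)
  have q_eq: "q = r powr s"
  proof -
    have "s * ln r = ln q"
      using L by (simp add: s_def L_def)
    then show ?thesis
      using r_pos q_pos by (simp add: powr_def)
  qed
  define G where "G = 1 + 2 * (real m + 1) / (q * L)"
  have G: "1 \<le> G" "2 * (real m + 1) / (q * L) \<le> G"
    using q_pos L by (auto simp: G_def)
  define A where "A = G * (1 / (\<delta> * r\<^sup>2)) powr s"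
  have "0 < A" using G \<delta> r_pos by (simp add: A_def)
  moreover have "measure \<mu> (ball x R) \<le> A * (1 + \<bar>ln R\<bar>) * (R / \<rho>) powr s * measure \<mu> (ball x \<rho>)"
    if x: "0 \<le> x" "x \<le> 1" and R: "0 < \<rho>" "\<rho> < R" "R \<le> \<delta>" for x R \<rho>
  proof -
    obtain n k where nk: "R \<le> \<delta> * r ^ n" "\<delta> * r ^ Suc n < R" "r ^ (n + k) < \<rho>"
      "r * \<rho> \<le> r ^ (n + k)"
      using geometric_scales[OF r_pos r_less_1 \<delta> R] by blast
    define M where "M = (\<Sum>w\<in>coverers n x. weight p w)"
    have "measure \<mu> (ball x R)
        \<le> (\<Sum>w | w \<in> words m n \<and> S w 0 < x + R \<and> x - R < S w 1. weight p w)"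
      by (rule measure_ball_le[OF ss supp]) (rule less_imp_le[OF p_pos])
    also have "\<dots> \<le> (1 + 2 * (real n * (real m + 1) / q)) * M"
      unfolding M_def using q p_le_1 q_pos a b x sep nk(1)
      by (intro weight_near[where q = q and p = p and a = a and b = b and \<delta> = \<delta>])
        (simp_all add: q_def)
    also have "(1 + 2 * (real n * (real m + 1) / q)) * M \<le> G * (1 + \<bar>ln R\<bar>) * M"
    proof (rule mult_right_mono)
      have "\<delta> * r ^ n \<le> r ^ n"
        using \<delta> r_pos by (simp add: mult_left_le_one_le)
      then have "R \<le> r ^ n" using nk(1) by simp
      then have "ln R \<le> real n * ln r"
        using R r_pos by (metis ln_mono ln_realpow less_trans)
      then have "real n * L \<le> \<bar>ln R\<bar>"
        by (simp add: L_def)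
      then have "real n \<le> \<bar>ln R\<bar> / L"
        using L by (simp add: field_simps)
      then have "2 * (real m + 1) / q * real n \<le> 2 * (real m + 1) / q * (\<bar>ln R\<bar> / L)"
        using q_pos by (intro mult_left_mono) auto
      also have "\<dots> \<le> G * \<bar>ln R\<bar>"
        using mult_right_mono[OF G(2), of "\<bar>ln R\<bar>"] by simp
      finally show "1 + 2 * (real n * (real m + 1) / q) \<le> G * (1 + \<bar>ln R\<bar>)"
        using G(1) by (simp add: algebra_simps)
      show "0 \<le> M"
        unfolding M_def using p_pos
        by (intro sum_nonneg weight_nonneg[of _ m n]) (auto simp: coverers_def less_imp_le)
    qed
    also have "\<dots> \<le> G * (1 + \<bar>ln R\<bar>) * ((1 / q ^ k) * measure \<mu> (ball x \<rho>))"
    proof (rule mult_left_mono)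
      have "q ^ k * M \<le> measure \<mu> (ball x \<rho>)"
        unfolding M_def q_def using q(2) q_pos
        by (intro measure_ball_ge[OF ss supp _ _ nk(3)]) (auto simp: q_def)
      then show "M \<le> (1 / q ^ k) * measure \<mu> (ball x \<rho>)"
        using q_pos by (simp add: field_simps)
    qed (use G in simp)
    also have "\<dots> \<le> G * (1 + \<bar>ln R\<bar>) *
        (((1 / (\<delta> * r\<^sup>2)) powr s * (R / \<rho>) powr s) * measure \<mu> (ball x \<rho>))"
    proof (intro mult_left_mono mult_right_mono)
      have "1 / r ^ k = r ^ n / r ^ (n + k)"
        using r_pos by (simp add: power_add)
      also have "\<dots> \<le> (R / (\<delta> * r)) / (r * \<rho>)"
        using nk R \<delta> r_pos by (intro frac_le) (auto simp: field_simps)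
      also have "\<dots> = 1 / (\<delta> * r\<^sup>2) * (R / \<rho>)"
        by (simp add: power2_eq_square)
      finally have "(1 / r ^ k) powr s \<le> (1 / (\<delta> * r\<^sup>2) * (R / \<rho>)) powr s"
        using r_pos s by (intro powr_mono2) auto
      also have "\<dots> = (1 / (\<delta> * r\<^sup>2)) powr s * (R / \<rho>) powr s"
        using \<delta> r_pos R by (intro powr_mult)
      finally have "(1 / r ^ k) powr s \<le> (1 / (\<delta> * r\<^sup>2)) powr s * (R / \<rho>) powr s" .
      moreover have "(r ^ k) powr s = q ^ k"
      proof -
        have "(r ^ k) powr s = (r powr real k) powr s"
          using r_pos by (simp add: powr_realpow)
        also have "\<dots> = (r powr s) powr real k"
          by (simp add: powr_powr mult.commute)
        also have "\<dots> = q ^ k"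
          using q_pos by (simp add: powr_realpow flip: q_eq)
        finally show ?thesis .
      qed
      ultimately show "1 / q ^ k \<le> (1 / (\<delta> * r\<^sup>2)) powr s * (R / \<rho>) powr s"
        using r_pos by (simp add: powr_divide)
    qed (use G in auto)
    finally show ?thesis
      by (simp add: A_def mult_ac)
  qed
  ultimately show ?thesis
    using \<delta>(1) that by blast
qed

section \<open>Dimension bounds\<close>

text \<open>The condition on \<open>\<phi>\<close> is \<open>c ln \<bar>ln R\<bar> \<le> \<phi> \<bar>ln R\<bar>\<close>, and \<open>\<rho> < R\<^sup>1\<^sup>+\<^sup>\<phi>\<close> is \<open>\<phi> \<bar>ln R\<bar> < ln (R / \<rho>)\<close>.\<close>

lemma abs_ln_le_ratio_powr:
  fixes R \<rho> \<phi> c :: real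
  assumes R: "0 < R" "R < 1" and \<rho>: "0 < \<rho>" "\<rho> < R powr (1 + \<phi>)" and c: "0 < c"
    and \<phi>: "c * (ln \<bar>ln R\<bar> / \<bar>ln R\<bar>) \<le> \<phi>"
  shows "\<bar>ln R\<bar> \<le> (R / \<rho>) powr (1 / c)"
proof -
  have l: "0 < - ln R" using R by (simp add: ln_less_zero_iff)
  have "ln \<rho> < (1 + \<phi>) * ln R"
    using \<rho> R by (metis ln_less_cancel_iff ln_powr powr_gt_zero less_irrefl)
  then have "\<phi> * (- ln R) \<le> ln (R / \<rho>)"
    using R \<rho> by (simp add: ln_div algebra_simps)
  moreover have "c * ln (- ln R) \<le> \<phi> * (- ln R)"
    using \<phi> l by (simp add: field_simps)
  ultimately have "c * ln (- ln R) \<le> ln (R / \<rho>)"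
    by linarith
  then have "ln (- ln R) \<le> 1 / c * ln (R / \<rho>)"
    using c by (simp add: field_simps)
  then have "exp (ln (- ln R)) \<le> exp (1 / c * ln (R / \<rho>))"
    by simp
  then show ?thesis
    using l R \<rho> by (simp add: powr_def)
qed

text \<open>A logarithmic loss in doubling costs only \<open>1 / c\<close> in the exponent.  The bound on \<open>\<Phi>\<close> is asked
  only below some \<open>\<epsilon>\<close>, and the resulting exponent does not depend on \<open>\<epsilon>\<close>; this uniformity is what
  the quasi-Assouad dimension needs.\<close>

lemma upper_Phi_dim_le_of_logarithmic:
  assumes bound: "\<And>x R \<rho>. x \<in> measure_support \<mu> \<Longrightarrow> 0 < \<rho> \<Longrightarrow> \<rho> < R \<Longrightarrow> R \<le> \<delta> \<Longrightarrow>
      measure \<mu> (ball x R) \<le> A * (1 + \<bar>ln R\<bar>) * (R / \<rho>) powr s * measure \<mu> (ball x \<rho>)"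
    and "0 < \<delta>" "0 < A" "0 < c" "0 < \<epsilon>"
    and \<Phi>: "\<And>R. 0 < R \<Longrightarrow> R < \<epsilon> \<Longrightarrow> R < 1 \<Longrightarrow> c * (ln \<bar>ln R\<bar> / \<bar>ln R\<bar>) \<le> \<Phi> R"
  shows "upper_Phi_dim \<Phi> \<mu> \<le> ereal (s + 1 / c)"
proof -
  define C where "C = min \<delta> (min (\<epsilon> / 2) (1 / 2))"
  have C: "0 < C" "C < 1" "C \<le> \<delta>" "C < \<epsilon>"
    using assms by (auto simp: C_def)
  have "measure \<mu> (ball x R) / measure \<mu> (ball x \<rho>) \<le> 2 * A * (R / \<rho>) powr (s + 1 / c)"
    if x: "x \<in> measure_support \<mu>" and \<rho>: "0 < \<rho>" "\<rho> < R powr (1 + \<Phi> R)"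
      "R powr (1 + \<Phi> R) \<le> R" and R: "0 < R" "R \<le> C" for x R \<rho>
  proof -
    have ln_le: "\<bar>ln R\<bar> \<le> (R / \<rho>) powr (1 / c)"
      using C R \<rho> \<open>0 < c\<close> by (intro abs_ln_le_ratio_powr[of R \<rho> "\<Phi> R"] \<Phi>) auto
    have "1 \<le> (R / \<rho>) powr (1 / c)"
      using \<rho> R \<open>0 < c\<close> by (intro ge_one_powr_ge_zero) auto
    with ln_le have "1 + \<bar>ln R\<bar> \<le> 2 * (R / \<rho>) powr (1 / c)"
      by simp
    then have "A * (1 + \<bar>ln R\<bar>) * (R / \<rho>) powr s \<le> A * (2 * (R / \<rho>) powr (1 / c)) * (R / \<rho>) powr s"
      using \<open>0 < A\<close> by (intro mult_left_mono mult_right_mono) auto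
    also have "\<dots> = 2 * A * (R / \<rho>) powr (s + 1 / c)"
      by (simp add: powr_add)
    finally have le: "A * (1 + \<bar>ln R\<bar>) * (R / \<rho>) powr s \<le> 2 * A * (R / \<rho>) powr (s + 1 / c)" .
    have "measure \<mu> (ball x R) \<le> 2 * A * (R / \<rho>) powr (s + 1 / c) * measure \<mu> (ball x \<rho>)"
      using bound[OF x \<rho>(1), of R] \<rho> R C mult_right_mono[OF le measure_nonneg[of \<mu> "ball x \<rho>"]]
      by auto
    then show ?thesis
      using \<open>0 < A\<close> by (cases "measure \<mu> (ball x \<rho>) = 0")
        (auto simp: divide_le_eq zero_less_measure_iff)
  qed
  then show ?thesis
    unfolding upper_Phi_dim_def using C \<open>0 < A\<close>
    by (intro Inf_lower imageI CollectI exI[of _ C] exI[of _ "2 * A"]) auto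
qed

text \<open>A larger \<open>\<Phi>\<close> leaves fewer pairs of scales to be compared.\<close>

lemma upper_Phi_dim_antimono:
  assumes "\<And>R. 0 < R \<Longrightarrow> R < 1 \<Longrightarrow> 0 \<le> \<Phi> R" and "\<And>R. 0 < R \<Longrightarrow> R < 1 \<Longrightarrow> \<Phi> R \<le> \<Psi> R"
  shows "upper_Phi_dim \<Psi> \<mu> \<le> upper_Phi_dim \<Phi> \<mu>"
proof -
  have pow: "R powr (1 + \<Psi> R) \<le> R powr (1 + \<Phi> R)" "R powr (1 + \<Phi> R) \<le> R"
    if "0 < R" "R < 1" for R
    using powr_mono'[of "1 + \<Phi> R" "1 + \<Psi> R" R] powr_mono'[of 1 "1 + \<Phi> R" R]
      assms[OF that] that by auto
  show ?thesis
    unfolding upper_Phi_dim_def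
  proof (intro Inf_superset_mono image_mono Collect_mono impI, elim exE conjE)
    fix \<alpha> C1 C2 :: real
    assume C: "0 < C1" "C1 < 1" "0 < C2"
      and bound: "\<forall>r R. \<forall>x\<in>measure_support \<mu>.
        0 < r \<longrightarrow> r < R powr (1 + \<Phi> R) \<longrightarrow> R powr (1 + \<Phi> R) \<le> R \<longrightarrow> 0 < R \<longrightarrow> R \<le> C1 \<longrightarrow>
        measure \<mu> (ball x R) / measure \<mu> (ball x r) \<le> C2 * (R / r) powr \<alpha>"
    have "measure \<mu> (ball x R) / measure \<mu> (ball x r) \<le> C2 * (R / r) powr \<alpha>"
      if "x \<in> measure_support \<mu>" "0 < r" "r < R powr (1 + \<Psi> R)" "0 < R" "R \<le> C1" for r R x
      using bound pow[of R] that C by (auto dest: order.strict_trans2)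
    with C show "\<exists>C1 C2. 0 < C1 \<and> C1 < 1 \<and> 0 < C2 \<and>
       (\<forall>r R. \<forall>x\<in>measure_support \<mu>.
        0 < r \<longrightarrow> r < R powr (1 + \<Psi> R) \<longrightarrow> R powr (1 + \<Psi> R) \<le> R \<longrightarrow> 0 < R \<longrightarrow> R \<le> C1 \<longrightarrow>
        measure \<mu> (ball x R) / measure \<mu> (ball x r) \<le> C2 * (R / r) powr \<alpha>)"
      by blast
  qed
qed

text \<open>The \<open>\<Phi>\<^sub>\<theta>\<close>-dimensions increase with \<open>\<theta>\<close>, so their limit at \<open>1\<close> exists and equals their
  supremum.\<close>

lemma quasi_Assouad_dim_le:
  assumes "\<And>\<theta>. 0 < \<theta> \<Longrightarrow> \<theta> < 1 \<Longrightarrow> upper_Phi_dim (\<lambda>_. 1 / \<theta> - 1) \<mu> \<le> B"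
  shows "quasi_Assouad_dim \<mu> \<le> B"
proof -
  define f where "f \<theta> = upper_Phi_dim (\<lambda>_. 1 / \<theta> - 1) \<mu>" for \<theta> :: real
  define l where "l = (SUP \<theta>\<in>{0<..<1}. f \<theta>)"
  have mono: "f \<theta> \<le> f \<eta>" if "0 < \<theta>" "\<theta> \<le> \<eta>" "\<eta> < 1" for \<theta> \<eta>
    unfolding f_def using that by (intro upper_Phi_dim_antimono) (auto simp: field_simps)
  have unit: "eventually (\<lambda>\<theta>. 0 < \<theta> \<and> \<theta> < (1::real)) (at_left 1)"
    unfolding eventually_at_left_field by (intro exI[of _ 0]) auto
  have "(f \<longlongrightarrow> l) (at_left 1)"
  proof (rule order_tendstoI)
    fix y assume "y < l"
    then obtain \<theta> where \<theta>: "0 < \<theta>" "\<theta> < 1" "y < f \<theta>"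
      by (auto simp: l_def less_SUP_iff)
    then show "eventually (\<lambda>\<eta>. y < f \<eta>) (at_left 1)"
      unfolding eventually_at_left_field
      by (intro exI[of _ \<theta>]) (auto intro: less_le_trans[OF _ mono])
  next
    fix y assume "l < y"
    have "f \<theta> < y" if "0 < \<theta>" "\<theta> < 1" for \<theta>
    proof -
      have "f \<theta> \<le> l"
        unfolding l_def using that by (intro SUP_upper) simp
      then show ?thesis
        using \<open>l < y\<close> by (rule le_less_trans)
    qed
    then show "eventually (\<lambda>\<eta>. f \<eta> < y) (at_left 1)"
      using unit by (auto elim: eventually_mono)
  qed
  then have "quasi_Assouad_dim \<mu> = l"
    unfolding quasi_Assouad_dim_def f_def[symmetric]
    by (intro tendsto_Lim) auto
  also have "\<dots> \<le> B"
    unfolding l_def f_def using assms by (intro SUP_least) auto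
  finally show ?thesis .
qed

lemma eventually_loglog_quotient_less:
  assumes "0 < (e::real)"
  shows "\<exists>\<epsilon>>0. \<forall>R. 0 < R \<longrightarrow> R < \<epsilon> \<longrightarrow> ln \<bar>ln R\<bar> / \<bar>ln R\<bar> < e"
proof -
  have "filterlim (\<lambda>R::real. \<bar>ln R\<bar>) at_top (at_right 0)"
    using filterlim_compose[OF filterlim_uminus_at_top_at_bot ln_at_0]
    by (rule filterlim_at_top_mono) (intro always_eventually allI abs_ge_minus_self)
  then have "((\<lambda>R. ln \<bar>ln R\<bar> / \<bar>ln R\<bar>) \<longlongrightarrow> 0) (at_right (0::real))"
    by (rule filterlim_compose[OF ln_x_over_x_tendsto_0])
  then have "eventually (\<lambda>R. ln \<bar>ln R\<bar> / \<bar>ln R\<bar> < e) (at_right (0::real))"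
    using assms by (rule order_tendstoD)
  then show ?thesis
    unfolding eventually_at_right_field by auto
qed

theorem corollary3p10:
  fixes r :: real and m :: nat and d p :: "nat \<Rightarrow> real" and \<mu> :: "real measure"
  assumes "equicontractive_ifs r m d p"
    and "self_similar_measure r m d p \<mu>"
    and "finite_type r m d"
    and "regular_ifs m d p"
    and "measure_support \<mu> = {0..1}"
  shows "(\<forall>\<Phi>. dimension_function \<Phi> \<longrightarrow>
            (\<exists>c>0. \<forall>x\<in>{0<..<1}. \<Phi> x \<ge> c * (ln \<bar>ln x\<bar> / \<bar>ln x\<bar>)) \<longrightarrow>
            upper_Phi_dim \<Phi> \<mu> < \<infinity>)
         \<and> quasi_Assouad_dim \<mu> < \<infinity>"
proof -
  obtain \<delta> A s where pos: "0 < \<delta>" "0 < A" and bound: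
    "\<And>x R \<rho>. 0 \<le> x \<Longrightarrow> x \<le> 1 \<Longrightarrow> 0 < \<rho> \<Longrightarrow> \<rho> < R \<Longrightarrow> R \<le> \<delta> \<Longrightarrow>
       measure \<mu> (ball x R) \<le> A * (1 + \<bar>ln R\<bar>) * (R / \<rho>) powr s * measure \<mu> (ball x \<rho>)"
    using ball_ratio_logarithmic[OF assms] by blast
  have dim_le: "upper_Phi_dim \<Phi> \<mu> \<le> ereal (s + 1 / c)"
    if "0 < c" "0 < \<epsilon>"
      "\<And>R. 0 < R \<Longrightarrow> R < \<epsilon> \<Longrightarrow> R < 1 \<Longrightarrow> c * (ln \<bar>ln R\<bar> / \<bar>ln R\<bar>) \<le> \<Phi> R" for \<Phi> c \<epsilon>
    using pos that assms(5)
    by (intro upper_Phi_dim_le_of_logarithmic[where \<delta> = \<delta> and A = A and \<epsilon> = \<epsilon>] bound) auto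
  have "upper_Phi_dim \<Phi> \<mu> < \<infinity>"
    if "0 < c" "\<forall>x\<in>{0<..<1}. \<Phi> x \<ge> c * (ln \<bar>ln x\<bar> / \<bar>ln x\<bar>)" for \<Phi> c
    using dim_le[of c 1 \<Phi>] that by (auto intro: le_less_trans)
  \<comment> \<open>The rate \<open>c = 1\<close> serves every \<open>\<theta>\<close>; only the range of scales depends on \<open>\<theta>\<close>.\<close>
  moreover have "quasi_Assouad_dim \<mu> \<le> ereal (s + 1 / 1)"
  proof (rule quasi_Assouad_dim_le)
    fix \<theta> :: real assume \<theta>: "0 < \<theta>" "\<theta> < 1"
    obtain \<epsilon> where "0 < \<epsilon>"
      "\<And>R. 0 < R \<Longrightarrow> R < \<epsilon> \<Longrightarrow> ln \<bar>ln R\<bar> / \<bar>ln R\<bar> < 1 / \<theta> - 1"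
      using eventually_loglog_quotient_less[of "1 / \<theta> - 1"] \<theta> by auto
    then show "upper_Phi_dim (\<lambda>_. 1 / \<theta> - 1) \<mu> \<le> ereal (s + 1 / 1)"
      by (intro dim_le[of 1 \<epsilon>]) (auto simp only: mult_1 zero_less_one intro: less_imp_le)
  qed
  then have "quasi_Assouad_dim \<mu> < \<infinity>"
    by (rule le_less_trans) simp
  ultimately show ?thesis by blast
qed

end
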